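(* Let $d\ge1$. For $m\ge0$ and $\mathbf x\in\mathbb R^d$ with $r=\|\mathbf x\|_2>0$, let $H_{0,m}$, $H_{1,m}$ and $\boldsymbol H^{\mathbf e_k}_{1,m}$ ($k=0,\dots,d-1$) be the Laplacian Hermite polynomials defined in the context. Then $$H_{0,0}(\mathbf x)=1,\qquad H_{1,0}(\mathbf x)=r,$$ and for all $m\ge1$, $$H_{0,m}(\mathbf x)=r\,H_{1,m-1}(\mathbf x)-\bigl(d+2(m-1)\bigr)H_{0,m-1}(\mathbf x),$$ $$H_{1,m}(\mathbf x)=r\,H_{0,m}(\mathbf x)-2m\,H_{1,m-1}(\mathbf x),$$ and for all $m\ge0$ and $k=0,\dots,d-1$, $$\boldsymbol H^{\mathbf e_k}_{1,m}(\mathbf x)=\frac{\mathbf x_k}{r}\,H_{1,m}(\mathbf x).$$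
   Context: Let $\Delta=\sum_{k=0}^{d-1}\partial^2/\partial\mathbf x_k^2$ be the Laplacian on $\mathbb R^d$, $\Delta^m$ its $m$-th power, and $r=\|\mathbf x\|_2$ with $\partial/\partial r$ the radial derivative. Define $$H_{0,m}(\mathbf x)=e^{r^2/2}\Delta^m e^{-r^2/2},\qquad H_{1,m}(\mathbf x)=-e^{r^2/2}\frac{\partial}{\partial r}\Delta^m e^{-r^2/2},\qquad \boldsymbol H^{\mathbf e_k}_{1,m}(\mathbf x)=-e^{r^2/2}\Delta^m\frac{\partial}{\partial\mathbf x_k}e^{-r^2/2}.$$ *)

theory Defs
  imports "HOL-Analysis.Analysis"
begin

definition partial_deriv :: "'n::finite \<Rightarrow> (real ^ 'n \<Rightarrow> real) \<Rightarrow> real ^ 'n \<Rightarrow> real" where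
  "partial_deriv k f x = deriv (\<lambda>t. f (x + t *\<^sub>R axis k 1)) 0"

definition laplacian :: "(real ^ 'n::finite \<Rightarrow> real) \<Rightarrow> real ^ 'n \<Rightarrow> real" where
  "laplacian f x = (\<Sum>k\<in>UNIV. partial_deriv k (partial_deriv k f) x)"

text \<open>In polar coordinates \<open>x = s *\<^sub>R \<omega>\<close> with \<open>\<omega> = x /\<^sub>R norm x\<close>, this is the
  derivative in \<open>s\<close> at \<open>s = norm x\<close>; it is meaningful only for \<open>x \<noteq> 0\<close>.\<close>

definition radial_deriv :: "(real ^ 'n::finite \<Rightarrow> real) \<Rightarrow> real ^ 'n \<Rightarrow> real" where
  "radial_deriv f x = deriv (\<lambda>s. f (s *\<^sub>R (x /\<^sub>R norm x))) (norm x)"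

definition gaussian :: "real ^ 'n::finite \<Rightarrow> real" where
  "gaussian x = exp (- (norm x)\<^sup>2 / 2)"

definition H0 :: "nat \<Rightarrow> real ^ 'n::finite \<Rightarrow> real" where
  "H0 m x = exp ((norm x)\<^sup>2 / 2) * (laplacian ^^ m) gaussian x"

definition H1 :: "nat \<Rightarrow> real ^ 'n::finite \<Rightarrow> real" where
  "H1 m x = - (exp ((norm x)\<^sup>2 / 2) * radial_deriv ((laplacian ^^ m) gaussian) x)"

definition H1_vec :: "'n::finite \<Rightarrow> nat \<Rightarrow> real ^ 'n \<Rightarrow> real" where
  "H1_vec k m x = - (exp ((norm x)\<^sup>2 / 2) * (laplacian ^^ m) (partial_deriv k gaussian) x)"

end

(* On functions x \<mapsto> p(|x|^2) exp(-|x|^2/2) with p a polynomial, differentiation acts through the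
   single operator D p = 2 p' - p: the k-th partial derivative yields x_k (D p)(|x|^2) exp(-|x|^2/2),
   and the Laplacian acts on p as L d p = d D p + s D (D p), where s = |x|^2. On multiples of x_k it
   acts as L (d + 2), and D (L d p) = L (d + 2) (D p). With p_m the m-th iterate of L d at 1,
   H_{0,m} = p_m and H_{1,m} = -r D p_m, so the claims reduce to polynomial identities that follow from
   the commutation rule D (s p) = 2 p + s D p by induction on m. *)

theory Submission
  imports Defs "HOL-Computational_Algebra.Polynomial"
begin

definition gauss_poly :: "real poly \<Rightarrow> real ^ 'n::finite \<Rightarrow> real" where
  "gauss_poly p x = poly p ((norm x)\<^sup>2) * exp (- (norm x)\<^sup>2 / 2)"

text \<open>The derivative of \<open>p(s) * exp(-s/2)\<close> in \<open>s\<close> is half of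
  \<open>(gdiff p)(s) * exp(-s/2)\<close>; the scaling by 2 absorbs the factor 2 in the derivative
  of a squared norm.\<close>

definition gdiff :: "real poly \<Rightarrow> real poly" where
  "gdiff p = smult 2 (pderiv p) - p"

text \<open>The parameter \<open>c\<close> is kept free, since both the dimension and the dimension
  plus 2 occur. Here \<open>pCons 0\<close> is multiplication by \<open>s\<close>.\<close>

definition radial_lap :: "real \<Rightarrow> real poly \<Rightarrow> real poly" where
  "radial_lap c p = smult c (gdiff p) + pCons 0 (gdiff (gdiff p))"

definition lap_poly :: "real \<Rightarrow> nat \<Rightarrow> real poly" where
  "lap_poly c m = (radial_lap c ^^ m) 1"

lemma gdiff_add: "gdiff (p + q) = gdiff p + gdiff q"
  by (simp add: gdiff_def pderiv_add smult_add_right)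

lemma gdiff_smult: "gdiff (smult c p) = smult c (gdiff p)"
  by (simp add: gdiff_def pderiv_smult smult_diff_right mult.commute)

lemma gdiff_minus: "gdiff (- p) = - gdiff p"
  using gdiff_smult[of "-1" p] by simp

lemma gdiff_diff: "gdiff (p - q) = gdiff p - gdiff q"
  using gdiff_add[of p "- q"] by (simp add: gdiff_minus)

lemma gdiff_pCons_0: "gdiff (pCons 0 p) = smult 2 p + pCons 0 (gdiff p)"
  by (simp add: gdiff_def pderiv_pCons smult_add_right)

text \<open>Moving \<open>gdiff\<close> past the factor \<open>s\<close> leaves one extra term
  \<open>2 * gdiff (gdiff p)\<close>, which raises \<open>c\<close> by 2. This is the polynomial
  shadow of a partial derivative commuting with the Laplacian.\<close>

lemma gdiff_radial_lap: "gdiff (radial_lap c p) = radial_lap (c + 2) (gdiff p)"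
  by (simp add: radial_lap_def gdiff_add gdiff_smult gdiff_pCons_0 smult_add_left)

lemma gdiff_lap_poly: "gdiff (lap_poly c m) = (radial_lap (c + 2) ^^ m) (gdiff 1)"
  by (induction m) (simp_all add: lap_poly_def gdiff_radial_lap)

lemma lap_poly_Suc: "lap_poly c (Suc m) = radial_lap c (lap_poly c m)"
  by (simp add: lap_poly_def)

lemma poly_gdiff_pCons_0: "poly (gdiff (pCons 0 p)) s = 2 * poly p s + s * poly (gdiff p) s"
  by (simp add: gdiff_pCons_0)

lemma poly_radial_lap:
  "poly (radial_lap c p) s = c * poly (gdiff p) s + s * poly (gdiff (gdiff p)) s"
  by (simp add: radial_lap_def)

text \<open>The two recurrences support each other: \<open>?A m\<close> gives \<open>?B m\<close> by
  applying \<open>gdiff\<close>, and \<open>?B m\<close> with the definition of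
  \<open>radial_lap\<close> gives \<open>?A (Suc m)\<close>.\<close>

lemma lap_poly_recurrences:
  shows lap_poly_rec: "lap_poly c (Suc m)
      = - pCons 0 (gdiff (lap_poly c m)) - smult (c + 2 * real m) (lap_poly c m)" (is "?A m")
    and gdiff_lap_poly_rec: "gdiff (lap_poly c (Suc m))
      = - lap_poly c (Suc m) - smult (2 * real (Suc m)) (gdiff (lap_poly c m))" (is "?B m")
proof -
  have gdiff_step: "?B m" if "?A m" for m
  proof -
    let ?p = "lap_poly c m"
    have "gdiff (lap_poly c (Suc m)) = gdiff (- pCons 0 (gdiff ?p) - smult (c + 2 * real m) ?p)"
      using that by (rule arg_cong)
    also have "\<dots> = - (smult 2 (gdiff ?p) + pCons 0 (gdiff (gdiff ?p)))
        - smult (c + 2 * real m) (gdiff ?p)"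
      by (simp only: gdiff_minus gdiff_diff gdiff_smult gdiff_pCons_0)
    \<comment> \<open>By definition of \<open>radial_lap\<close>, the term
      \<open>pCons 0 (gdiff (gdiff ?p))\<close> equals
      \<open>lap_poly c (Suc m) - smult c (gdiff ?p)\<close>; the multiples of \<open>c\<close> then
      cancel.\<close>
    finally show ?thesis
      by (simp add: lap_poly_Suc radial_lap_def poly_eq_poly_eq_iff[symmetric] fun_eq_iff
          algebra_simps)
  qed
  have step: "?A m" for m
  proof (induction m)
    case 0
    \<comment> \<open>Since \<open>gdiff 1 = -1\<close>, both sides are
      \<open>s - c\<close>.\<close>
    show ?case
      by (simp add: lap_poly_def radial_lap_def gdiff_def pderiv_minus)
  next
    case (Suc m)
    let ?p = "lap_poly c m" and ?q = "lap_poly c (Suc m)"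
    have q: "gdiff ?q = - ?q - smult (2 * real (Suc m)) (gdiff ?p)"
      by (rule gdiff_step[OF Suc.IH])
    have qq: "gdiff (gdiff ?q) = - gdiff ?q - smult (2 * real (Suc m)) (gdiff (gdiff ?p))"
      by (subst q) (simp only: gdiff_minus gdiff_diff gdiff_smult)
    have "poly (lap_poly c (Suc (Suc m))) s
      = poly (- pCons 0 (gdiff ?q) - smult (c + 2 * real (Suc m)) ?q) s" for s
    proof -
      have "poly (lap_poly c (Suc (Suc m))) s = c * poly (gdiff ?q) s
          + (- s * poly (gdiff ?q) s - 2 * real (Suc m) * (s * poly (gdiff (gdiff ?p)) s))"
        by (simp add: lap_poly_Suc[of c "Suc m"] poly_radial_lap qq algebra_simps)
      also have "s * poly (gdiff (gdiff ?p)) s = poly ?q s - c * poly (gdiff ?p) s"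
        by (simp add: lap_poly_Suc poly_radial_lap)
      \<comment> \<open>Only the occurrence with factor \<open>c\<close> is rewritten; the one with
        factor \<open>- s\<close> already fits the goal. The terms in
        \<open>c * poly (gdiff ?p) s\<close> then cancel.\<close>
      also have "c * poly (gdiff ?q) s
          = - c * poly ?q s - 2 * real (Suc m) * (c * poly (gdiff ?p) s)"
        by (subst q) (simp add: algebra_simps)
      finally show ?thesis
        by (simp add: algebra_simps)
    qed
    then show ?case
      by (simp add: poly_eq_poly_eq_iff[symmetric] fun_eq_iff)
  qed
  show "?A m" by (rule step)
  show "?B m" by (rule gdiff_step[OF step])
qed

text \<open>The inner function is arbitrary so that the squared norm along a coordinate line and
  along a ray are both instances.\<close>

lemma poly_exp_has_derivative:
  fixes p :: "real poly"
  assumes "(g has_real_derivative 2 * g') (at t)"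
  shows "((\<lambda>t. poly p (g t) * exp (- g t / 2)) has_real_derivative
    g' * (poly (gdiff p) (g t) * exp (- g t / 2))) (at t)"
proof -
  have "((\<lambda>t. exp (- g t / 2)) has_real_derivative exp (- g t / 2) * - g') (at t)"
    by (auto intro!: derivative_eq_intros assms)
  from DERIV_mult[OF DERIV_chain2[OF poly_DERIV assms] this] show ?thesis
    by (rule DERIV_cong) (simp add: gdiff_def algebra_simps)
qed

lemma gauss_poly_line_derivative:
  fixes x :: "real ^ 'n::finite"
  shows "((\<lambda>t. gauss_poly p (x + t *\<^sub>R axis k 1)) has_real_derivative
    x $ k * gauss_poly (gdiff p) x) (at 0)"
proof -
  \<comment> \<open>The squared norm is a polynomial in \<open>t\<close>, so the derivative exists
    even at \<open>x = 0\<close>, where the norm itself is not differentiable.\<close>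
  have norm_line: "(norm (x + t *\<^sub>R axis k 1))\<^sup>2 = (norm x)\<^sup>2 + 2 * t * x $ k + t\<^sup>2" for t
    unfolding power2_norm_eq_inner
    by (simp add: inner_add_left inner_add_right inner_axis inner_axis' power2_eq_square algebra_simps)
  have "((\<lambda>t. (norm x)\<^sup>2 + 2 * t * x $ k + t\<^sup>2) has_real_derivative 2 * x $ k) (at 0)"
    by (auto intro!: derivative_eq_intros)
  from poly_exp_has_derivative[OF this, of p] show ?thesis
    by (simp add: gauss_poly_def norm_line)
qed

lemma component_line_derivative:
  fixes x :: "real ^ 'n::finite"
  shows "((\<lambda>t. (x + t *\<^sub>R axis k 1) $ j) has_real_derivative of_bool (j = k)) (at 0)"
  by (auto simp: axis_def intro!: derivative_eq_intros)

lemma partial_deriv_gauss_poly: "partial_deriv k (gauss_poly p) = (\<lambda>x. x $ k * gauss_poly (gdiff p) x)"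
  unfolding partial_deriv_def by (intro ext DERIV_imp_deriv gauss_poly_line_derivative)

lemma partial_deriv_component_gauss_poly:
  "partial_deriv k (\<lambda>x. x $ j * gauss_poly p x)
    = (\<lambda>x. of_bool (j = k) * gauss_poly p x + x $ j * x $ k * gauss_poly (gdiff p) x)"
  unfolding partial_deriv_def
  by (intro ext DERIV_imp_deriv
      DERIV_cong[OF DERIV_mult[OF component_line_derivative gauss_poly_line_derivative]])
     (simp add: algebra_simps)

text \<open>The function has the shape produced by the preceding lemma, so for
  \<open>q = gdiff p\<close> this is a second partial derivative of
  \<open>x $ j * gauss_poly p x\<close>, up to renaming.\<close>

lemma partial_deriv_two_component_gauss_poly:
  "partial_deriv k (\<lambda>x. of_bool (j = k) * gauss_poly p x + x $ j * x $ k * gauss_poly q x) x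
    = of_bool (j = k) * (x $ k * gauss_poly (gdiff p) x + x $ k * gauss_poly q x)
      + x $ j * (gauss_poly q x + (x $ k)\<^sup>2 * gauss_poly (gdiff q) x)"
  unfolding partial_deriv_def
  by (intro DERIV_imp_deriv
      DERIV_cong[OF DERIV_add[OF DERIV_cmult[OF gauss_poly_line_derivative]
        DERIV_mult[OF DERIV_mult[OF component_line_derivative component_line_derivative]
          gauss_poly_line_derivative]]])
     (simp add: algebra_simps power2_eq_square)

lemma power2_norm_eq_sum_components: "(norm x)\<^sup>2 = (\<Sum>k\<in>UNIV. (x $ k)\<^sup>2)" for x :: "real ^ 'n::finite"
  unfolding power2_norm_eq_inner by (simp add: inner_vec_def power2_eq_square)

lemma gauss_poly_radial_lap:
  "gauss_poly (radial_lap c p) x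
    = c * gauss_poly (gdiff p) x + (norm x)\<^sup>2 * gauss_poly (gdiff (gdiff p)) x"
  by (simp add: gauss_poly_def poly_radial_lap algebra_simps)

text \<open>Each second partial derivative contributes \<open>gauss_poly (gdiff p) x\<close> once,
  and \<open>gauss_poly (gdiff (gdiff p)) x\<close> with weight \<open>(x $ k)\<^sup>2\<close>; the
  weights sum to the squared norm.\<close>

lemma laplacian_gauss_poly:
  "laplacian (gauss_poly p :: real ^ 'n::finite \<Rightarrow> real) = gauss_poly (radial_lap (real CARD('n)) p)"
  by (rule ext)
     (simp add: laplacian_def partial_deriv_gauss_poly partial_deriv_component_gauss_poly
      gauss_poly_radial_lap power2_norm_eq_sum_components sum.distrib sum_distrib_right
      flip: power2_eq_square)

lemma laplacian_component_gauss_poly: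
  "laplacian (\<lambda>x :: real ^ 'n::finite. x $ j * gauss_poly p x)
    = (\<lambda>x. x $ j * gauss_poly (radial_lap (real CARD('n) + 2) p) x)"
proof
  fix x :: "real ^ 'n"
  \<comment> \<open>The leading 2 comes from the index \<open>k = j\<close>, where the factor
    \<open>x $ j\<close> is differentiated in either of the two derivatives.\<close>
  have "laplacian (\<lambda>x. x $ j * gauss_poly p x) x
      = 2 * (x $ j * gauss_poly (gdiff p) x) + x $ j * (real CARD('n) * gauss_poly (gdiff p) x
        + (norm x)\<^sup>2 * gauss_poly (gdiff (gdiff p)) x)"
    by (simp add: laplacian_def partial_deriv_component_gauss_poly
        partial_deriv_two_component_gauss_poly sum.distrib power2_norm_eq_sum_components
        flip: sum_distrib_left sum_distrib_right)
  then show "laplacian (\<lambda>x. x $ j * gauss_poly p x) x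
      = x $ j * gauss_poly (radial_lap (real CARD('n) + 2) p) x"
    by (simp add: gauss_poly_radial_lap algebra_simps)
qed

lemma gaussian_eq_gauss_poly: "gaussian = gauss_poly 1"
  by (simp add: fun_eq_iff gaussian_def gauss_poly_def)

lemma laplacian_power_gaussian:
  "(laplacian ^^ m) (gaussian :: real ^ 'n::finite \<Rightarrow> real) = gauss_poly (lap_poly (real CARD('n)) m)"
  by (induction m)
     (simp_all add: gaussian_eq_gauss_poly laplacian_gauss_poly lap_poly_def)

lemma laplacian_power_partial_deriv_gaussian:
  "(laplacian ^^ m) (partial_deriv k (gaussian :: real ^ 'n::finite \<Rightarrow> real))
    = (\<lambda>x. x $ k * gauss_poly (gdiff (lap_poly (real CARD('n)) m)) x)"
  \<comment> \<open>This places \<open>gdiff\<close> innermost, matching the partial derivative that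
    acts before the Laplacians, so the induction can peel off one Laplacian at a time.\<close>
  unfolding gdiff_lap_poly
  by (induction m)
     (simp_all add: gaussian_eq_gauss_poly partial_deriv_gauss_poly laplacian_component_gauss_poly)

lemma radial_deriv_gauss_poly:
  assumes "x \<noteq> 0"
  shows "radial_deriv (gauss_poly p) x = norm x * gauss_poly (gdiff p) x"
proof -
  have "((\<lambda>s. s\<^sup>2) has_real_derivative 2 * norm x) (at (norm x))"
    by (auto intro!: derivative_eq_intros)
  from poly_exp_has_derivative[OF this, of p]
  have "deriv (\<lambda>s. poly p (s\<^sup>2) * exp (- s\<^sup>2 / 2)) (norm x) = norm x * gauss_poly (gdiff p) x"
    unfolding gauss_poly_def by (rule DERIV_imp_deriv)
  \<comment> \<open>For \<open>x \<noteq> 0\<close> the direction has norm 1. Squaring makes the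
    identity hold for negative \<open>s\<close> as well.\<close>
  moreover have "(norm (s *\<^sub>R (x /\<^sub>R norm x)))\<^sup>2 = s\<^sup>2" for s
    using assms by (simp add: power_mult_distrib field_simps)
  ultimately show ?thesis
    by (simp add: radial_deriv_def gauss_poly_def)
qed

lemma exp_mult_gauss_poly: "exp ((norm x)\<^sup>2 / 2) * gauss_poly p x = poly p ((norm x)\<^sup>2)"
  by (simp add: gauss_poly_def exp_minus)

lemma H0_eq_poly: "H0 m x = poly (lap_poly (real CARD('n)) m) ((norm x)\<^sup>2)"
  for x :: "real ^ 'n::finite"
  by (simp add: H0_def laplacian_power_gaussian exp_mult_gauss_poly)

lemma H1_eq_poly: "x \<noteq> 0 \<Longrightarrow> H1 m x = - norm x * poly (gdiff (lap_poly (real CARD('n)) m)) ((norm x)\<^sup>2)"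
  for x :: "real ^ 'n::finite"
  by (simp add: H1_def laplacian_power_gaussian radial_deriv_gauss_poly mult.left_commute[of "exp _"]
      exp_mult_gauss_poly)

text \<open>The polynomial factor is the one in \<open>H1_eq_poly\<close>; only the prefactor
  changes from \<open>- norm x\<close> to \<open>- x $ k\<close>, which explains the ratio
  \<open>x $ k / r\<close>.\<close>

lemma H1_vec_eq_poly: "H1_vec k m x = - x $ k * poly (gdiff (lap_poly (real CARD('n)) m)) ((norm x)\<^sup>2)"
  for x :: "real ^ 'n::finite"
  by (simp add: H1_vec_def laplacian_power_partial_deriv_gaussian mult.left_commute[of "exp _"]
      exp_mult_gauss_poly)

theorem mainTheorem4:
  fixes x :: "real ^ 'n::finite" and r :: real
  assumes "r = norm x" and "r > 0"
  shows "H0 0 x = 1 \<and> H1 0 x = r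
    \<and> (\<forall>m\<ge>1. H0 m x = r * H1 (m - 1) x - (real CARD('n) + 2 * (real m - 1)) * H0 (m - 1) x)
    \<and> (\<forall>m\<ge>1. H1 m x = r * H0 m x - 2 * real m * H1 (m - 1) x)
    \<and> (\<forall>m k. H1_vec k m x = x $ k / r * H1 m x)"
proof (intro conjI allI impI)
  have "x \<noteq> 0"
    using assms by auto
  note H1 = H1_eq_poly[OF this, folded assms(1)]
  note H0 = H0_eq_poly[of _ x, folded assms(1)]
  show "H0 0 x = 1"
    by (simp add: H0 lap_poly_def)
  show "H1 0 x = r"
    by (simp add: H1 lap_poly_def gdiff_def)
  show "H0 m x = r * H1 (m - 1) x - (real CARD('n) + 2 * (real m - 1)) * H0 (m - 1) x"
    if m: "1 \<le> m" for m
  proof -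
    obtain n where "m = Suc n"
      using m by (cases m) auto
    \<comment> \<open>In \<open>?A n\<close>, the term
      \<open>- pCons 0 (gdiff (lap_poly c n))\<close> evaluates at \<open>r\<^sup>2\<close> to
      \<open>r * H1 n x\<close>, and \<open>real m - 1\<close> becomes
      \<open>real n\<close>.\<close>
    then show ?thesis
      by (simp add: H0 H1 lap_poly_rec power2_eq_square)
  qed
  show "H1 m x = r * H0 m x - 2 * real m * H1 (m - 1) x" if m: "1 \<le> m" for m
  proof -
    obtain n where "m = Suc n"
      using m by (cases m) auto
    \<comment> \<open>This is \<open>?B n\<close> evaluated at \<open>r\<^sup>2\<close> and
      multiplied by \<open>- r\<close>.\<close>
    then show ?thesis
      by (simp add: H0 H1 gdiff_lap_poly_rec algebra_simps)
  qed
  show "H1_vec k m x = x $ k / r * H1 m x" for m k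
    using assms by (simp add: H1 H1_vec_eq_poly)
qed

end
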